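(* Let $I\subset\mathbb{R}$ be an open interval, $n\in\mathbb{N}$, $q\in\mathbb{N}$ an even integer, $\alpha\in\,]-1,+\infty[$ and $f\in C^{n+2+q}(I)$. Then $$\forall x\in I_h,\quad D^{(n)}_{h,\alpha,\alpha,q}f(x)=f^{(n)}(x)+O(h^{q+2})$$ (as $h\to0^+$). Moreover, if there exists $M_{n+2+q}>0$ such that $|f^{(n+q+2)}(x)|\le M_{n+2+q}$ for any $x\in I$, then $$\left\|D^{(n)}_{h,\alpha,\alpha,q}f(x)-f^{(n)}(x)\right\|_\infty\le\hat C_2h^{q+2},$$ where $\hat C_2=\frac{M_{n+2+q}}{(n+q+2)!}\int_{-1}^{1}\left|t^{n+q+2}Q_{\alpha,n,q}(t)\right|dt$ and $$Q_{\alpha,n,q}(t)=\sum_{i=0}^{q/2}P_{2i}^{(\alpha+n,\alpha+n)}(0)\sum_{j=0}^{2i}(-1)^{j}\binom{2i}{j}\frac{4i+2\alpha+2n+1}{2i+2\alpha+2n+1}\,\rho_{n,\alpha_{2i,j},\beta_j}(t),$$ with $\alpha_{2i,j}=\alpha+2i-j$, $\beta_j=\alpha+j$ (for $i=0$ the quotient is understood as $1$).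
   Context: $\mathbb{N}$ includes $0$. For $h>0$, $I_h:=\{x\in I:\ [x-h,x+h]\subset I\}$, and $\|\cdot\|_\infty$ denotes the supremum over $x\in I_h$. For $\alpha,\beta>-1$: $P_n^{(\alpha,\beta)}(t)=\sum_{j=0}^{n}\binom{n+\alpha}{j}\binom{n+\beta}{n-j}\left(\frac{t-1}{2}\right)^{n-j}\left(\frac{t+1}{2}\right)^{j}$ is the $n$-th Jacobi polynomial, $w_{\alpha,\beta}(t)=(1-t)^{\alpha}(1+t)^{\beta}$, $\langle g_1(\cdot),g_2(\cdot)\rangle_{\alpha,\beta}=\int_{-1}^{1}w_{\alpha,\beta}(t)g_1(t)g_2(t)\,dt$ for $g_1,g_2\in C^0([-1,1])$, and $\|\cdot\|_{\alpha,\beta}$ is the associated norm. With $B(a,b)=\Gamma(a)\Gamma(b)/\Gamma(a+b)$, $$\rho_{n,\alpha,\beta}(t)=\frac{2^{-(n+\alpha+\beta+1)}\,n!}{B(n+\alpha+1,n+\beta+1)}P_n^{(\alpha,\beta)}(t)\,w_{\alpha,\beta}(t).$$ The affine estimators with $\alpha=\beta$ are, for $x\in I_h$, $$D^{(n)}_{h,\alpha,\alpha,q}f(x)=\sum_{i=0}^{q}\frac{\left\langle P_i^{(\alpha+n,\alpha+n)}(\cdot),f^{(n)}(x+h\,\cdot)\right\rangle_{\alpha+n,\alpha+n}}{\|P_i^{(\alpha+n,\alpha+n)}\|^2_{\alpha+n,\alpha+n}}\,P_i^{(\alpha+n,\alpha+n)}(0).$$ *)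

theory Defs
  imports "HOL-Analysis.Analysis" "HOL-Library.Landau_Symbols"
begin

text \<open>The class \<open>C\<^sup>k\<close> on an open set. Since \<open>S\<close> is meant to be open, the values of
  \<open>(deriv ^^ j) f\<close> on \<open>S\<close> depend only on the values of \<open>f\<close> on \<open>S\<close>.\<close>

definition C_on :: "nat \<Rightarrow> real set \<Rightarrow> (real \<Rightarrow> real) \<Rightarrow> bool" where
  "C_on k S f \<longleftrightarrow>
     (\<forall>j<k. \<forall>x\<in>S. (deriv ^^ j) f field_differentiable (at x)) \<and>
     continuous_on S ((deriv ^^ k) f)"

definition shrink :: "real set \<Rightarrow> real \<Rightarrow> real set" where
  "shrink I h = {x \<in> I. {x - h..x + h} \<subseteq> I}"

text \<open>The supremum is taken in the extended reals, so that it is \<open>\<infinity>\<close> for an unbounded function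
  (and \<open>-\<infinity>\<close> on the empty set).\<close>

definition sup_norm_on :: "real set \<Rightarrow> (real \<Rightarrow> real) \<Rightarrow> ereal" where
  "sup_norm_on S g = (SUP x\<in>S. ereal \<bar>g x\<bar>)"

definition jacobi :: "nat \<Rightarrow> real \<Rightarrow> real \<Rightarrow> real \<Rightarrow> real" where
  "jacobi n \<alpha> \<beta> t =
     (\<Sum>j=0..n. ((real n + \<alpha>) gchoose j) * ((real n + \<beta>) gchoose (n - j))
        * ((t - 1) / 2) ^ (n - j) * ((t + 1) / 2) ^ j)"

text \<open>At the endpoints \<open>t = 1\<close> and \<open>t = -1\<close> the convention \<open>0 powr a = 0\<close> applies;
  the weight is only used under integrals over \<open>[-1,1]\<close>.\<close>

definition jweight :: "real \<Rightarrow> real \<Rightarrow> real \<Rightarrow> real" where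
  "jweight \<alpha> \<beta> t = (1 - t) powr \<alpha> * (1 + t) powr \<beta>"

definition jinner :: "real \<Rightarrow> real \<Rightarrow> (real \<Rightarrow> real) \<Rightarrow> (real \<Rightarrow> real) \<Rightarrow> real" where
  "jinner \<alpha> \<beta> g1 g2 = (LINT t:{-1..1}|lborel. jweight \<alpha> \<beta> t * g1 t * g2 t)"

definition jnorm :: "real \<Rightarrow> real \<Rightarrow> (real \<Rightarrow> real) \<Rightarrow> real" where
  "jnorm \<alpha> \<beta> g = sqrt (jinner \<alpha> \<beta> g g)"

definition rho :: "nat \<Rightarrow> real \<Rightarrow> real \<Rightarrow> real \<Rightarrow> real" where
  "rho n \<alpha> \<beta> t =
     2 powr (- (real n + \<alpha> + \<beta> + 1)) * fact n / Beta (real n + \<alpha> + 1) (real n + \<beta> + 1)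
       * jacobi n \<alpha> \<beta> t * jweight \<alpha> \<beta> t"

definition affine_est :: "nat \<Rightarrow> real \<Rightarrow> real \<Rightarrow> nat \<Rightarrow> (real \<Rightarrow> real) \<Rightarrow> real \<Rightarrow> real" where
  "affine_est n h \<alpha> q f x =
     (let a = \<alpha> + real n in
      \<Sum>i=0..q. jinner a a (jacobi i a a) (\<lambda>t. (deriv ^^ n) f (x + h * t))
                / (jnorm a a (jacobi i a a))\<^sup>2 * jacobi i a a 0)"

text \<open>For \<open>i = 0\<close> the quotient is read as \<open>1\<close>; this matters when
  \<open>2 * \<alpha> + 2 * n + 1 = 0\<close>, where it would be \<open>0 / 0\<close>.\<close>

definition Qker :: "real \<Rightarrow> nat \<Rightarrow> nat \<Rightarrow> real \<Rightarrow> real" where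
  "Qker \<alpha> n q t =
     (\<Sum>i=0..q div 2. jacobi (2 * i) (\<alpha> + real n) (\<alpha> + real n) 0 *
        (\<Sum>j=0..2 * i. (- 1) ^ j * real ((2 * i) choose j)
           * (if i = 0 then 1
              else (4 * real i + 2 * \<alpha> + 2 * real n + 1) / (2 * real i + 2 * \<alpha> + 2 * real n + 1))
           * rho n (\<alpha> + 2 * real i - real j) (\<alpha> + real j) t))"

end

theory Submission
  imports Defs
begin

text \<open>
  Let \<open>a = \<alpha> + n\<close>. The estimator applies to \<open>g(t) = f\<^sup>(\<^sup>n\<^sup>)(x + h t)\<close> the orthogonal projection onto the
  polynomials of degree at most \<open>q\<close>, with respect to the weight \<open>(1 - t\<^sup>2)\<^sup>a\<close> on \<open>[-1,1]\<close>, and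
  evaluates the result at \<open>0\<close>. It is therefore exact, that is, it returns \<open>g(0) = f\<^sup>(\<^sup>n\<^sup>)(x)\<close>, when
  \<open>g\<close> is a polynomial of degree at most \<open>q\<close>; since \<open>q\<close> is even and the Jacobi polynomial of odd
  degree \<open>q + 1\<close> vanishes at \<open>0\<close>, it is exact even for degree \<open>q + 1\<close>
  (\<open>jacobi_expansion_0\<close>).

  The kernel \<^const>\<open>Qker\<close> expresses the estimator without derivatives of \<open>f\<close>. By the Rodrigues
  formula, \<open>P\<^sub>n w\<close> with exponents \<open>c, d\<close> is up to a constant the \<open>n\<close>-th derivative of the weight
  with exponents \<open>c + n, d + n\<close>, and \<open>n\<close> integrations by parts move these derivatives onto the function
  (\<open>jinner_jacobi_eq_integral_deriv\<close>). Conversely \<open>P\<^sub>i\<close> times the weight with exponents \<open>a, a\<close>,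
  divided by the squared norm of \<open>P\<^sub>i\<close>, is an explicit combination of such higher weights
  (\<open>jacobi_jweight_normalized\<close>), whose \<open>n\<close>-th derivatives are the functions \<^const>\<open>rho\<close>. This gives
  \<open>h\<^sup>n D f(x) = \<integral> Q(t) f(x + h t) dt\<close> (\<open>affine_est_eq_LINT_Qker\<close>). The same integration by parts
  yields the orthogonality relations and the norms of the Jacobi polynomials (\<open>jinner_jacobi_poly\<close>).

  By exactness \<open>\<integral> Q p\<close> is the \<open>n\<close>-th derivative of \<open>p\<close> at \<open>0\<close> for all polynomials \<open>p\<close> of
  degree at most \<open>n + q + 1\<close> (\<open>LINT_Qker_poly\<close>). Apply this to the Taylor polynomial of
  \<open>t \<mapsto> f(x + h t)\<close>: what is left of the error is \<open>h\<^sup>-\<^sup>n \<integral> Q R\<close> with the Taylor remainder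
  \<open>\<bar>R(t)\<bar> \<le> M / N! h\<^sup>N \<bar>t\<bar>\<^sup>N\<close>, \<open>N = n + q + 2\<close>, which is the asserted bound
  (\<open>affine_est_error\<close>). For the asymptotic statement at a single point, \<open>M\<close> is taken on a compact
  neighbourhood of this point.
\<close>

section \<open>The Jacobi weight\<close>

text \<open>This is the Euler Beta integral after the substitution \<open>t \<mapsto> (1 + t) / 2\<close>.\<close>

lemma jweight_has_integral:
  assumes "c > -1" "d > -1"
  shows "(jweight c d has_integral 2 powr (c + d + 1) * Beta (c + 1) (d + 1)) {-1..1}"
proof -
  have "((\<lambda>t. t powr (d + 1 - 1) * (1 - t) powr (c + 1 - 1)) has_integral Beta (d + 1) (c + 1)) {0..1}"
    using assms by (intro has_integral_Beta_real) auto
  hence "((\<lambda>t. t powr d * (1 - t) powr c) has_integral Beta (d + 1) (c + 1)) (cbox 0 1)"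
    by simp
  from has_integral_affinity'[OF this, of "1/2" "1/2"]
  have "((\<lambda>t. ((1 + t) / 2) powr d * ((1 - t) / 2) powr c) has_integral 2 * Beta (d + 1) (c + 1)) {-1..1}"
    by (simp add: field_simps)
  hence "((\<lambda>t. 2 powr (c + d) * (((1 + t) / 2) powr d * ((1 - t) / 2) powr c))
      has_integral 2 powr (c + d) * (2 * Beta (d + 1) (c + 1))) {-1..1}"
    by (rule has_integral_mult_right)
  moreover have "2 powr (c + d) * (2 * Beta (d + 1) (c + 1)) = 2 powr (c + d + 1) * Beta (c + 1) (d + 1)"
    by (simp add: powr_add Beta_commute)
  ultimately show ?thesis
  proof (subst has_integral_cong)
    fix t :: real assume "t \<in> {-1..1}"
    thus "jweight c d t = 2 powr (c + d) * (((1 + t) / 2) powr d * ((1 - t) / 2) powr c)"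
      by (simp add: jweight_def powr_divide powr_add)
  qed simp_all
qed

lemma jweight_nonneg: "jweight c d t \<ge> 0"
  by (simp add: jweight_def)

lemma jweight_measurable [measurable]: "jweight c d \<in> borel_measurable borel"
  unfolding jweight_def by measurable

lemma set_integrable_jweight:
  assumes "c > -1" "d > -1"
  shows "set_integrable lborel {-1..1} (jweight c d)"
proof -
  have "jweight c d absolutely_integrable_on {-1..1}"
    using jweight_has_integral[OF assms] jweight_nonneg
    by (intro nonnegative_absolutely_integrable_1) (auto simp: integrable_on_def)
  thus ?thesis
    unfolding set_integrable_def by (subst (asm) integrable_completion) auto
qed

lemma LINT_jweight:
  assumes "c > -1" "d > -1"
  shows "(LINT t:{-1..1}|lborel. jweight c d t) = 2 powr (c + d + 1) * Beta (c + 1) (d + 1)"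
  using set_borel_integral_eq_integral(2)[OF set_integrable_jweight[OF assms]]
    jweight_has_integral[OF assms] by (simp add: integral_unique)

text \<open>The weight may be unbounded at the endpoints, so integrability has to come from the weight; a
  continuous factor on the compact interval is bounded and does not destroy it. All later
  integrability facts rest on this one.\<close>

lemma set_integrable_jweight_mult:
  assumes "c > -1" "d > -1" and g: "continuous_on {-1..1} g"
  shows "set_integrable lborel {-1..1} (\<lambda>t. jweight c d t * g t)"
proof -
  obtain B where "\<forall>t\<in>{-1..1}. \<bar>g t\<bar> \<le> B"
    using compact_imp_bounded[OF compact_continuous_image[OF g compact_Icc]]
    unfolding bounded_iff by auto
  hence B: "\<bar>g t\<bar> \<le> B" if "t \<in> {-1..1}" for t
    using that by blast
  have *: "(\<lambda>t. indicator {-1..1} t *\<^sub>R g t) \<in> borel_measurable borel"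
    using g by (intro borel_measurable_continuous_on_indicator) auto
  have "(\<lambda>t. jweight c d t * (indicator {-1..1} t *\<^sub>R g t)) \<in> borel_measurable borel"
    using * by measurable
  hence "set_borel_measurable lborel {-1..1} (\<lambda>t. jweight c d t * g t)"
    unfolding set_borel_measurable_def by (simp add: mult_ac)
  thus ?thesis
  proof (rule set_integrable_bound[rotated])
    show "set_integrable lborel {-1..1} (\<lambda>t. B * jweight c d t)"
      using set_integrable_jweight[OF assms(1,2)] by simp
    show "AE x in lborel. x \<in> {- 1..1} \<longrightarrow> norm (jweight c d x * g x) \<le> norm (B * jweight c d x)"
      using B jweight_nonneg[of c d]
      by (intro AE_I2) (force simp: abs_mult mult.commute[of B] intro!: mult_left_mono)
  qed
qed

lemma continuous_on_jacobi [continuous_intros]: "continuous_on S (jacobi k c d)"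
  unfolding jacobi_def by (intro continuous_intros) auto

section \<open>The Rodrigues formula and integration by parts\<close>

text \<open>Each factor \<open>1 - t\<close> or \<open>1 + t\<close> of a term of the Jacobi polynomial is absorbed by the weight and
  raises one of its exponents. This also holds at the endpoints, where all the weights vanish by
  the convention \<open>0 powr a = 0\<close>, so that integrands may be rewritten on the closed interval.\<close>

lemma jacobi_jweight:
  assumes "t \<in> {-1..1}"
  shows "jacobi k c d t * jweight c d t =
    (\<Sum>j=0..k. (-1) ^ (k - j) / 2 ^ k * ((real k + c) gchoose j) * ((real k + d) gchoose (k - j))
       * jweight (c + real (k - j)) (d + real j) t)"
proof (cases "t = 1 \<or> t = -1")
  case True
  thus ?thesis by (auto simp: jweight_def)
next
  case False
  hence t: "1 - t > 0" "1 + t > 0" using assms by auto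
  have *: "((t - 1) / 2) ^ (k - j) * ((t + 1) / 2) ^ j * jweight c d t
      = (-1) ^ (k - j) / 2 ^ k * jweight (c + real (k - j)) (d + real j) t" if "j \<le> k" for j
  proof -
    have "((t - 1) / 2) ^ (k - j) = (-1) ^ (k - j) * (1 - t) ^ (k - j) / 2 ^ (k - j)"
      by (metis minus_diff_eq mult_minus1 power_divide power_mult_distrib)
    moreover have "(2::real) ^ k = 2 ^ (k - j) * 2 ^ j"
      using that by (simp flip: power_add)
    ultimately show ?thesis using t
      by (simp add: jweight_def powr_add powr_realpow power_divide add.commute[of t 1])
  qed
  show ?thesis
    unfolding jacobi_def sum_distrib_right
  proof (intro sum.cong refl)
    fix j assume "j \<in> {0..k}"
    hence j: "j \<le> k" by simp
    have "(real k + c gchoose j) * (real k + d gchoose (k - j)) * ((t - 1) / 2) ^ (k - j) *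
        ((t + 1) / 2) ^ j * jweight c d t
      = (real k + c gchoose j) * (real k + d gchoose (k - j)) *
        (((t - 1) / 2) ^ (k - j) * ((t + 1) / 2) ^ j * jweight c d t)"
      by (simp only: mult.assoc)
    also note *[OF j]
    finally show "(real k + c gchoose j) * (real k + d gchoose (k - j)) * ((t - 1) / 2) ^ (k - j) *
        ((t + 1) / 2) ^ j * jweight c d t
      = (-1) ^ (k - j) / 2 ^ k * (real k + c gchoose j) * (real k + d gchoose (k - j)) *
        jweight (c + real (k - j)) (d + real j) t"
      by (simp only: mult_ac)
  qed
qed

lemma has_real_derivative_jweight:
  assumes "t \<in> {-1<..<1}"
  shows "(jweight c d has_real_derivative - c * jweight (c - 1) d t + d * jweight c (d - 1) t) (at t)"
  unfolding jweight_def using assms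
  by (auto intro!: derivative_eq_intros simp: powr_diff field_simps)

text \<open>One step of the Rodrigues formula
  \<open>w\<^bsub>c,d\<^esub> P\<^sub>m = (-1)\<^sup>m / (2\<^sup>m m!) (d/dt)\<^sup>m w\<^bsub>c+m,d+m\<^esub>\<close>. With \<open>P w\<close> written as a sum of
  weights, differentiating the weight with index \<open>j\<close> yields those with indices \<open>j + 1\<close> and \<open>j\<close>, and
  two absorption identities for binomial coefficients recombine them with the factors \<open>j\<close> and
  \<open>k + 1 - j\<close>, whose sum \<open>k + 1\<close> does not depend on \<open>j\<close>.\<close>

lemma has_real_derivative_jacobi_jweight:
  assumes t: "t \<in> {-1<..<1}"
  shows "((\<lambda>t. jacobi k (c + 1) (d + 1) t * jweight (c + 1) (d + 1) t) has_real_derivative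
           - 2 * real (Suc k) * (jacobi (Suc k) c d t * jweight c d t)) (at t)"
proof -
  define A B where "A = real (Suc k) + c" and "B = real (Suc k) + d"
  define X where "X = (\<lambda>j. (-1) ^ (k - j) / 2 ^ k * (A gchoose j) * (B gchoose (k - j)))"
  define e where "e = (\<lambda>j. (-1) ^ (Suc k - j) / 2 ^ k * (A gchoose j) * (B gchoose (Suc k - j)))"
  define W where "W = (\<lambda>j. jweight (c + real (Suc k - j)) (d + real j) t)"
  have "((\<lambda>t. \<Sum>j=0..k. X j * jweight (c + 1 + real (k - j)) (d + 1 + real j) t)
      has_real_derivative
        (\<Sum>j=0..k. X j * (- (c + 1 + real (k - j)) * W (Suc j) + (d + 1 + real j) * W j))) (at t)"
    by (auto intro!: derivative_eq_intros sum.cong has_real_derivative_jweight t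
      simp: W_def Suc_diff_le algebra_simps)
  moreover have "(\<Sum>j=0..k. X j * (- (c + 1 + real (k - j)) * W (Suc j) + (d + 1 + real j) * W j))
      = - 2 * real (Suc k) * (jacobi (Suc k) c d t * jweight c d t)"
  proof -
    have "jacobi (Suc k) c d t * jweight c d t = (\<Sum>j=0..Suc k. e j * W j / 2)"
      using t unfolding e_def W_def A_def B_def
      by (subst jacobi_jweight) (auto intro!: sum.cong simp del: sum.cl_ivl_Suc)
    hence "- 2 * real (Suc k) * (jacobi (Suc k) c d t * jweight c d t)
        = - real (Suc k) * (\<Sum>j=0..Suc k. e j * W j)"
      by (simp only: sum_divide_distrib[symmetric])
    also have "\<dots> = (\<Sum>j=0..Suc k. - (real j * e j * W j) - real (Suc k - j) * e j * W j)"
      unfolding sum_distrib_left by (intro sum.cong refl) (auto simp: of_nat_diff algebra_simps)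
    also have "\<dots> = (\<Sum>j=0..Suc k. - (real j * e j * W j)) - (\<Sum>j=0..Suc k. real (Suc k - j) * e j * W j)"
      by (rule sum_subtractf)
    also have "(\<Sum>j=0..Suc k. - (real j * e j * W j)) = (\<Sum>j=0..k. - (real (Suc j) * e (Suc j) * W (Suc j)))"
      by (subst sum.atLeast0_atMost_Suc_shift) simp
    also have "(\<Sum>j=0..Suc k. real (Suc k - j) * e j * W j) = (\<Sum>j=0..k. real (Suc k - j) * e j * W j)"
      by simp
    also have "(\<Sum>j=0..k. - (real (Suc j) * e (Suc j) * W (Suc j))) - (\<Sum>j=0..k. real (Suc k - j) * e j * W j)
        = (\<Sum>j=0..k. X j * (- (c + 1 + real (k - j)) * W (Suc j) + (d + 1 + real j) * W j))"
      unfolding sum_subtractf[symmetric]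
    proof (intro sum.cong refl)
      fix j assume "j \<in> {0..k}"
      hence j: "j \<le> k" by simp
      have "real (Suc j) * (A gchoose Suc j) = (A - real j) * (A gchoose j)"
        using gbinomial_mult_1[of A j] by (simp add: algebra_simps)
      hence 1: "real (Suc j) * e (Suc j) = X j * (c + 1 + real (k - j))"
        using j by (simp add: e_def X_def A_def of_nat_diff mult_ac)
      have "real (Suc (k - j)) * (B gchoose Suc (k - j)) = (B - real (k - j)) * (B gchoose (k - j))"
        using gbinomial_mult_1[of B "k - j"] by (simp add: algebra_simps)
      hence 2: "real (Suc k - j) * e j = - (X j * (d + 1 + real j))"
        using j by (simp add: e_def X_def B_def of_nat_diff Suc_diff_le mult_ac)
      show "- (real (Suc j) * e (Suc j) * W (Suc j)) - real (Suc k - j) * e j * W j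
          = X j * (- (c + 1 + real (k - j)) * W (Suc j) + (d + 1 + real j) * W j)"
        unfolding 1 2 by (simp add: algebra_simps)
    qed
    finally show ?thesis ..
  qed
  ultimately have "((\<lambda>t. \<Sum>j=0..k. X j * jweight (c + 1 + real (k - j)) (d + 1 + real j) t)
      has_real_derivative - 2 * real (Suc k) * (jacobi (Suc k) c d t * jweight c d t)) (at t)"
    by simp
  thus ?thesis
  proof (rule has_field_derivative_transform_within_open[of _ _ _ "{-1<..<1}"])
    fix s :: real assume "s \<in> {-1<..<1}"
    thus "(\<Sum>j=0..k. X j * jweight (c + 1 + real (k - j)) (d + 1 + real j) s)
      = jacobi k (c + 1) (d + 1) s * jweight (c + 1) (d + 1) s"
      by (subst jacobi_jweight) (auto simp: X_def A_def B_def add_ac intro!: sum.cong)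
  qed (use t in auto)
qed

text \<open>The boundary terms vanish because both exponents \<open>c + 1\<close> and \<open>d + 1\<close> are positive. On the right
  the weight may be singular at the endpoints; the fundamental theorem of calculus is therefore
  used in the form that asks for a derivative only in the interior.\<close>

lemma jinner_by_parts:
  assumes cd: "c > -1" "d > -1"
    and der: "\<And>t. t \<in> {-1<..<1} \<Longrightarrow> (g has_real_derivative g' t) (at t)"
    and g: "continuous_on {-1..1} g" and g': "continuous_on {-1..1} g'"
  shows "jinner (c + 1) (d + 1) (jacobi k (c + 1) (d + 1)) g'
       = 2 * real (Suc k) * jinner c d (jacobi (Suc k) c d) g"
proof -
  define u where "u = (\<lambda>t. jacobi k (c + 1) (d + 1) t * jweight (c + 1) (d + 1) t)"
  define F where "F = (\<lambda>t. jweight (c + 1) (d + 1) t * (jacobi k (c + 1) (d + 1) t * g' t))"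
  define G where "G = (\<lambda>t. jweight c d t * (jacobi (Suc k) c d t * g t))"
  have intF: "set_integrable lborel {-1..1} F" and intG: "set_integrable lborel {-1..1} G"
    unfolding F_def G_def using cd by (intro set_integrable_jweight_mult continuous_intros g g'; simp)+
  have "continuous_on {-1..1} (\<lambda>t. u t * g t)"
    unfolding u_def jweight_def
    using cd by (intro continuous_intros g continuous_on_powr') auto
  moreover have "((\<lambda>t. u t * g t) has_vector_derivative F t - 2 * real (Suc k) * G t) (at t)"
    if "t \<in> {-1<..<1}" for t
  proof -
    have "(u has_real_derivative - 2 * real (Suc k) * (jacobi (Suc k) c d t * jweight c d t)) (at t)"
      unfolding u_def using that by (rule has_real_derivative_jacobi_jweight)
    from DERIV_mult[OF this der[OF that]]
    have "((\<lambda>t. u t * g t) has_real_derivative F t - 2 * real (Suc k) * G t) (at t)"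
      by (rule DERIV_cong) (simp add: u_def F_def G_def algebra_simps)
    thus ?thesis by (simp add: has_real_derivative_iff_has_vector_derivative)
  qed
  ultimately have "((\<lambda>t. F t - 2 * real (Suc k) * G t) has_integral u 1 * g 1 - u (-1) * g (-1)) {-1..1}"
    by (intro fundamental_theorem_of_calculus_interior) auto
  moreover have "u 1 = 0" "u (-1) = 0"
    by (auto simp: u_def jweight_def)
  ultimately have "integral {-1..1} (\<lambda>t. F t - 2 * real (Suc k) * G t) = 0"
    by (simp add: integral_unique)
  moreover have "set_integrable lborel {-1..1} (\<lambda>t. F t - 2 * real (Suc k) * G t)"
    using intF intG by (intro set_integral_diff) auto
  ultimately have "(LINT t:{-1..1}|lborel. F t - 2 * real (Suc k) * G t) = 0"
    using set_borel_integral_eq_integral(2) by metis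
  moreover have "(LINT t:{-1..1}|lborel. F t - 2 * real (Suc k) * G t)
      = (LINT t:{-1..1}|lborel. F t) - 2 * real (Suc k) * (LINT t:{-1..1}|lborel. G t)"
    using intF intG by (subst set_integral_diff) auto
  ultimately show ?thesis
    unfolding jinner_def F_def G_def by (simp add: mult.assoc)
qed

text \<open>Iterated integration by parts moves all \<open>m\<close> derivatives of the Rodrigues formula onto the
  function. The sequence \<open>G\<close> lists that function with its derivatives, which makes the lemma
  usable both for polynomials and for \<open>t \<mapsto> f (x + h t)\<close>.\<close>

lemma jinner_jacobi_eq_integral_deriv:
  assumes "c > -1" "d > -1"
    and "\<And>k t. k < m \<Longrightarrow> t \<in> {-1<..<1} \<Longrightarrow> (G k has_real_derivative G (Suc k) t) (at t)"
    and "\<And>k. k \<le> m \<Longrightarrow> continuous_on {-1..1} (G k)"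
  shows "2 ^ m * fact m * jinner c d (jacobi m c d) (G 0)
       = (LINT t:{-1..1}|lborel. jweight (c + real m) (d + real m) t * G m t)"
proof -
  \<comment> \<open>The left-hand side is what \<open>m - k\<close> integrations by parts make of the inner product with \<open>G 0\<close>.\<close>
  have "2 ^ k * fact k * jinner (c + real (m - k)) (d + real (m - k))
           (jacobi k (c + real (m - k)) (d + real (m - k))) (G (m - k))
       = (LINT t:{-1..1}|lborel. jweight (c + real m) (d + real m) t * G m t)" if "k \<le> m" for k
    using that
  proof (induction k)
    case 0
    show ?case by (simp add: jinner_def jacobi_def)
  next
    case (Suc k)
    define l where "l = m - Suc k"
    have l: "m - k = Suc l" "l < m" using Suc.prems by (auto simp: l_def)
    have "jinner (c + real l + 1) (d + real l + 1) (jacobi k (c + real l + 1) (d + real l + 1)) (G (Suc l))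
       = 2 * real (Suc k) * jinner (c + real l) (d + real l) (jacobi (Suc k) (c + real l) (d + real l)) (G l)"
      using assms l by (intro jinner_by_parts) auto
    moreover have "2 ^ k * fact k * jinner (c + real l + 1) (d + real l + 1)
           (jacobi k (c + real l + 1) (d + real l + 1)) (G (Suc l))
       = (LINT t:{-1..1}|lborel. jweight (c + real m) (d + real m) t * G m t)"
      using Suc.IH Suc.prems by (simp add: l(1) add_ac)
    ultimately show ?case
      unfolding l_def[symmetric] by (simp add: algebra_simps)
  qed
  from this[of m] show ?thesis by simp
qed

section \<open>Jacobi polynomials as polynomials\<close>

text \<open>The function \<^const>\<open>jacobi\<close> as a formal polynomial, which makes its degree, its leading
  coefficient and iterated derivatives accessible.\<close>

definition jacobi_poly :: "nat \<Rightarrow> real \<Rightarrow> real \<Rightarrow> real poly" where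
  "jacobi_poly k c d = (\<Sum>j=0..k. smult (((real k + c) gchoose j) * ((real k + d) gchoose (k - j)))
     ([:-1/2, 1/2:] ^ (k - j) * [:1/2, 1/2:] ^ j))"

lemma poly_jacobi_poly: "poly (jacobi_poly k c d) = jacobi k c d"
proof
  fix t
  show "poly (jacobi_poly k c d) t = jacobi k c d t"
    unfolding jacobi_poly_def jacobi_def poly_sum
    by (intro sum.cong refl) (simp add: diff_divide_distrib add_divide_distrib add.commute)
qed

lemma degree_jacobi_factor: "Polynomial.degree ([:-1/2, 1/2:] ^ l * [:1/2, 1/2 :: real:] ^ j) = l + j"
  by (subst degree_mult_eq) (auto simp: degree_power_eq)

lemma degree_jacobi_poly_le: "Polynomial.degree (jacobi_poly k c d) \<le> k"
  unfolding jacobi_poly_def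
proof (intro degree_sum_le)
  fix j assume "j \<in> {0..k}"
  thus "Polynomial.degree (smult ((real k + c gchoose j) * (real k + d gchoose (k - j)))
      ([:-1/2, 1/2:] ^ (k - j) * [:1/2, 1/2:] ^ j)) \<le> k"
    by (intro order.trans[OF degree_smult_le]) (simp only: degree_jacobi_factor, simp)
qed simp

text \<open>All terms of the defining sum have degree \<open>k\<close> and the same power of \<open>1/2\<close> as leading
  coefficient, so that the Vandermonde convolution adds them up.\<close>

lemma coeff_jacobi_poly:
  "coeff (jacobi_poly k c d) k = ((2 * real k + c + d) gchoose k) / 2 ^ k"
proof -
  have *: "coeff ([:-1/2, 1/2:] ^ (k - j) * [:1/2, 1/2 :: real:] ^ j) k = 1 / 2 ^ k" if "j \<le> k" for j
  proof -
    have "coeff ([:-1/2, 1/2:] ^ (k - j) * [:1/2, 1/2 :: real:] ^ j) k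
        = lead_coeff ([:-1/2, 1/2:] ^ (k - j) * [:1/2, 1/2 :: real:] ^ j)"
      using that by (subst degree_jacobi_factor) simp
    also have "\<dots> = (1/2) ^ (k - j) * (1/2) ^ j"
      by (simp add: lead_coeff_mult lead_coeff_power)
    also have "\<dots> = 1 / 2 ^ k"
      using that by (simp flip: power_add add: power_divide)
    finally show ?thesis .
  qed
  have "coeff (jacobi_poly k c d) k
      = (\<Sum>j=0..k. ((real k + c) gchoose j) * ((real k + d) gchoose (k - j)) * (1 / 2 ^ k))"
    unfolding jacobi_poly_def coeff_sum coeff_smult by (intro sum.cong refl) (simp only: * atLeastAtMost_iff)
  also have "\<dots> = ((real k + c + (real k + d)) gchoose k) * (1 / 2 ^ k)"
    by (simp only: sum_distrib_right[symmetric] gbinomial_Vandermonde)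
  finally show ?thesis by (simp add: add_ac)
qed

text \<open>Non-vanishing of the leading coefficients is what makes the Jacobi polynomials span.\<close>

lemma gbinomial_leading_pos:
  assumes "s > -2"
  shows "((2 * real k + s) gchoose k) > 0"
proof (cases "k = 0")
  case False
  hence pos: "2 * real k + s + 1 > 0" "2 * real k + s - real k + 1 > 0" using assms by linarith+
  hence "2 * real k + s + 1 \<notin> \<int>\<^sub>\<le>\<^sub>0" by (auto elim!: nonpos_Ints_cases)
  thus ?thesis using pos by (subst gbinomial_Gamma) (auto intro!: divide_pos_pos mult_pos_pos Gamma_real_pos)
qed simp

section \<open>Orthogonality and orthogonal expansion\<close>

lemma jinner_commute: "jinner c d f g = jinner c d g f"
  unfolding jinner_def by (simp add: mult.assoc mult.commute[of "f _"])

lemma set_integrable_jinner: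
  assumes "c > -1" "d > -1" "continuous_on {-1..1} f" "continuous_on {-1..1} g"
  shows "set_integrable lborel {-1..1} (\<lambda>t. jweight c d t * f t * g t)"
  unfolding mult.assoc using assms by (intro set_integrable_jweight_mult continuous_intros)

lemma jinner_add_smult_poly:
  assumes "c > -1" "d > -1" "continuous_on {-1..1} f"
  shows "jinner c d f (poly (p + smult s r)) = jinner c d f (poly p) + s * jinner c d f (poly r)"
proof -
  have "jinner c d f (poly (p + smult s r))
     = (LINT t:{-1..1}|lborel. jweight c d t * f t * poly p t + s * (jweight c d t * f t * poly r t))"
    unfolding jinner_def by (simp add: algebra_simps)
  also have "\<dots> = jinner c d f (poly p) + s * jinner c d f (poly r)"
    unfolding jinner_def using assms
    by (subst set_integral_add) (auto intro!: set_integrable_jinner continuous_intros)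
  finally show ?thesis .
qed

text \<open>After \<open>k\<close> integrations by parts only the \<open>k\<close>-th derivative of \<open>p\<close> matters, and this is the
  constant \<open>k!\<close> times the coefficient of \<open>t\<^sup>k\<close>. Both the orthogonality relations and the norms of
  the Jacobi polynomials are read off from this formula.\<close>

lemma jinner_jacobi_poly:
  assumes cd: "c > -1" "d > -1" and deg: "Polynomial.degree p \<le> k"
  shows "jinner c d (jacobi k c d) (poly p)
       = coeff p k * 2 powr (c + d + real k + 1) * Beta (c + real k + 1) (d + real k + 1)"
proof -
  have "2 ^ k * fact k * jinner c d (jacobi k c d) (poly ((pderiv ^^ 0) p))
      = (LINT t:{-1..1}|lborel. jweight (c + real k) (d + real k) t * poly ((pderiv ^^ k) p) t)"
    using cd by (intro jinner_jacobi_eq_integral_deriv[where G = "\<lambda>j. poly ((pderiv ^^ j) p)"])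
      (auto intro!: poly_DERIV continuous_intros)
  also have "(pderiv ^^ k) p = [:fact k * coeff p k:]"
  proof (rule poly_eqI)
    fix j
    show "coeff ((pderiv ^^ k) p) j = coeff [:fact k * coeff p k:] j"
      using deg by (cases j) (auto simp: coeff_higher_pderiv coeff_eq_0 pochhammer_fact)
  qed
  also have "(LINT t:{-1..1}|lborel. jweight (c + real k) (d + real k) t * poly [:fact k * coeff p k:] t)
      = fact k * coeff p k * (LINT t:{-1..1}|lborel. jweight (c + real k) (d + real k) t)"
    by (simp add: mult.commute)
  also have "\<dots> = fact k * coeff p k * (2 powr (c + real k + (d + real k) + 1) * Beta (c + real k + 1) (d + real k + 1))"
    using cd by (subst LINT_jweight) auto
  also have "2 powr (c + real k + (d + real k) + 1) = 2 powr real k * 2 powr (c + d + real k + 1)"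
    by (simp add: add_ac flip: powr_add)
  also have "2 powr real k = 2 ^ k"
    by (simp add: powr_realpow)
  finally show ?thesis by simp
qed

lemma jinner_jacobi_self:
  assumes "c > -1" "d > -1"
  shows "jinner c d (jacobi k c d) (jacobi k c d)
       = ((2 * real k + c + d) gchoose k) * 2 powr (c + d + 1) * Beta (c + real k + 1) (d + real k + 1)"
  using jinner_jacobi_poly[OF assms degree_jacobi_poly_le[of k c d]]
  by (simp add: poly_jacobi_poly coeff_jacobi_poly powr_add powr_realpow)

lemma jinner_jacobi_self_pos:
  assumes "c > -1" "d > -1"
  shows "jinner c d (jacobi k c d) (jacobi k c d) > 0"
  using assms gbinomial_leading_pos[of "c + d" k]
  by (simp add: jinner_jacobi_self Beta_def Gamma_real_pos add_ac)

lemma jinner_jacobi_orthogonal: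
  assumes "c > -1" "d > -1" "k \<noteq> l"
  shows "jinner c d (jacobi k c d) (jacobi l c d) = 0"
proof -
  have *: "jinner c d (jacobi k c d) (jacobi l c d) = 0" if "l < k" for k l
  proof -
    have "Polynomial.degree (jacobi_poly l c d) < k"
      using degree_jacobi_poly_le[of l c d] that by simp
    thus ?thesis
      using jinner_jacobi_poly[OF assms(1,2), of "jacobi_poly l c d" k]
      by (simp add: poly_jacobi_poly coeff_eq_0)
  qed
  show ?thesis
    using *[of k l] *[of l k] assms(3) by (metis jinner_commute linorder_neqE_nat)
qed

text \<open>The Jacobi polynomials of degree at most \<open>q\<close> form an orthogonal basis of the polynomials of
  degree at most \<open>q\<close>, and the sum is the orthogonal projection onto this space. The induction
  removes the leading term of \<open>p\<close> by a multiple of the Jacobi polynomial of the same degree; its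
  hypothesis bounds the coefficients and not the degree, because the zero polynomial, with
  which the descent ends, should count as having degree below \<open>0\<close>.\<close>

lemma jacobi_expansion:
  assumes cd: "c > -1" "d > -1" and deg: "Polynomial.degree p \<le> q"
  shows "(\<Sum>i=0..q. jinner c d (jacobi i c d) (poly p) / jinner c d (jacobi i c d) (jacobi i c d)
            * jacobi i c d x) = poly p x"
proof -
  define N where "N = (\<lambda>i. jinner c d (jacobi i c d) (jacobi i c d))"
  have N: "N i \<noteq> 0" for i using jinner_jacobi_self_pos[OF cd, of i] by (simp add: N_def)
  define L where "L = (\<lambda>p. \<Sum>i=0..q. jinner c d (jacobi i c d) (poly p) / N i * jacobi i c d x)"
  have "L p = poly p x" if "\<And>k. k \<ge> m \<Longrightarrow> coeff p k = 0" "m \<le> Suc q" for m p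
    using that
  proof (induction m arbitrary: p)
    case 0
    hence "p = 0" by (simp add: poly_eq_iff)
    thus ?case by (simp add: L_def jinner_def)
  next
    case (Suc m)
    define P where "P = jacobi_poly m c d"
    define s where "s = coeff p m / coeff P m"
    define r where "r = p - smult s P"
    have "coeff P m \<noteq> 0"
      using gbinomial_leading_pos[of "c + d" m] cd by (simp add: P_def coeff_jacobi_poly add_ac)
    moreover have "coeff P k = 0" if "k > m" for k
      using that degree_jacobi_poly_le[of m c d] by (simp add: P_def coeff_eq_0)
    ultimately have "coeff r k = 0" if "k \<ge> m" for k
      using that Suc.prems(1)[of k] by (cases "k = m") (auto simp: r_def s_def)
    hence "L r = poly r x" using Suc by auto
    moreover have "L P = poly P x"
    proof -
      have "L P = (\<Sum>i=0..q. if i = m then jacobi m c d x else 0)"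
        unfolding L_def P_def poly_jacobi_poly
      proof (intro sum.cong refl)
        fix i
        show "jinner c d (jacobi i c d) (jacobi m c d) / N i * jacobi i c d x = (if i = m then jacobi m c d x else 0)"
          using jinner_jacobi_orthogonal[OF cd, of i m] N[of m] by (auto simp: N_def)
      qed
      thus ?thesis using Suc.prems(2) by (simp add: P_def poly_jacobi_poly)
    qed
    moreover have "L (r + smult s P) = L r + s * L P"
      unfolding L_def using cd
      by (simp add: jinner_add_smult_poly continuous_on_jacobi add_divide_distrib distrib_right
          sum.distrib sum_distrib_left mult.assoc)
    moreover have "r + smult s P = p" by (simp add: r_def)
    ultimately show ?case by (metis poly_add poly_smult)
  qed
  from this[of "Suc q" p] show ?thesis
    using deg by (simp add: L_def N_def coeff_eq_0)
qed

section \<open>The value at the origin in the symmetric case\<close>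

text \<open>At the origin, reversing the order of summation changes the sign of the sum; a symmetric Jacobi
  polynomial of odd degree is an odd function.\<close>

lemma jacobi_odd_0:
  assumes "odd k"
  shows "jacobi k a a 0 = 0"
proof -
  have "jacobi k a a 0 = (\<Sum>j=0..k. (real k + a gchoose (k - j)) * (real k + a gchoose (k - (k - j)))
      * ((0 - 1) / 2) ^ (k - (k - j)) * ((0 + 1) / 2) ^ (k - j))"
    unfolding jacobi_def by (subst sum.atLeastAtMost_rev) simp
  also have "\<dots> = (\<Sum>j=0..k. - ((real k + a gchoose j) * (real k + a gchoose (k - j))
      * ((0 - 1) / 2) ^ (k - j) * ((0 + 1) / 2) ^ j))"
  proof (intro sum.cong refl)
    fix j assume "j \<in> {0..k}"
    hence j: "j \<le> k" by simp
    have "(-1) ^ j * (-1) ^ (k - j) = (-1 :: real)"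
      using assms j by (simp flip: power_add)
    hence "(-1) ^ j = - ((-1 :: real) ^ (k - j))"
      by (cases "even j"; cases "even (k - j)") auto
    moreover have *: "((0 - 1) / 2) ^ m = (-1) ^ m / (2 :: real) ^ m" for m
      by (simp only: power_divide diff_0)
    ultimately show "(real k + a gchoose (k - j)) * (real k + a gchoose (k - (k - j)))
      * ((0 - 1) / 2) ^ (k - (k - j)) * ((0 + 1) / 2) ^ (k - j)
      = - ((real k + a gchoose j) * (real k + a gchoose (k - j))
      * ((0 - 1) / 2) ^ (k - j) * ((0 + 1) / 2) ^ j)"
      using j unfolding * by (simp add: power_one_over mult_ac)
  qed
  also have "\<dots> = - jacobi k a a 0"
    unfolding jacobi_def by (rule sum_negf)
  finally show ?thesis by simp
qed

text \<open>For even \<open>q\<close> one degree is gained: the term with index \<open>q + 1\<close> of the full expansion vanishes at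
  the origin. This is the source of the exponent \<open>q + 2\<close> in the error estimate.\<close>

lemma jacobi_expansion_0:
  assumes "a > -1" "even q" "Polynomial.degree p \<le> q + 1"
  shows "(\<Sum>i=0..q. jinner a a (jacobi i a a) (poly p) / jinner a a (jacobi i a a) (jacobi i a a)
            * jacobi i a a 0) = poly p 0"
  using jacobi_expansion[OF assms(1,1), of p "Suc q" 0] assms(2,3) jacobi_odd_0[of "Suc q" a] by simp

section \<open>The kernel of the estimator\<close>

text \<open>The bridge between the coefficients of the Jacobi polynomial and its squared norm: both sides
  reduce to the same quotient of Gamma values. The exceptional case \<open>k = 0\<close> is necessary
  because \<open>2 * a + 1\<close> may be zero.\<close>

lemma gbinomial_mult_Beta:
  assumes a: "a > -1" and j: "j \<le> k"
  shows "((real k + a) gchoose j) * ((real k + a) gchoose (k - j)) * Beta (a + real (k - j) + 1) (a + real j + 1)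
       = real (k choose j) * (if k = 0 then 1 else (2 * real k + 2 * a + 1) / (real k + 2 * a + 1))
         * ((2 * real k + 2 * a) gchoose k) * Beta (a + real k + 1) (a + real k + 1)"
proof (cases "k = 0")
  case True
  thus ?thesis using j by simp
next
  case False
  have nz: "x \<notin> \<int>\<^sub>\<le>\<^sub>0" if "x > 0" for x :: real
    using that by (auto elim!: nonpos_Ints_cases)
  have G: "Gamma x \<noteq> 0" if "x > 0" for x :: real using Gamma_real_pos[OF that] by simp
  have pos: "real k + a + 1 > 0" "a + real j + 1 > 0" "a + real (k - j) + 1 > 0"
    "real k + 2 * a + 1 > 0" "2 * real k + 2 * a + 1 > 0"
    using False a by linarith+
  have 1: "((real k + a) gchoose j) = Gamma (real k + a + 1) / (fact j * Gamma (a + real (k - j) + 1))"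
    using j by (subst gbinomial_Gamma[OF nz[OF pos(1)]]) (simp add: of_nat_diff algebra_simps)
  have 2: "((real k + a) gchoose (k - j)) = Gamma (real k + a + 1) / (fact (k - j) * Gamma (a + real j + 1))"
    using j by (subst gbinomial_Gamma[OF nz[OF pos(1)]]) (simp add: of_nat_diff algebra_simps)
  have 3: "((2 * real k + 2 * a) gchoose k) = Gamma (2 * real k + 2 * a + 1) / (fact k * Gamma (real k + 2 * a + 1))"
    by (subst gbinomial_Gamma[OF nz[OF pos(5)]]) (simp add: algebra_simps)
  have 4: "Gamma (real k + 2 * a + 1 + 1) = (real k + 2 * a + 1) * Gamma (real k + 2 * a + 1)"
    by (rule Gamma_plus1[OF nz[OF pos(4)]])
  have 5: "Gamma (2 * real k + 2 * a + 1 + 1) = (2 * real k + 2 * a + 1) * Gamma (2 * real k + 2 * a + 1)"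
    by (rule Gamma_plus1[OF nz[OF pos(5)]])
  have "((real k + a) gchoose j) * ((real k + a) gchoose (k - j)) * Beta (a + real (k - j) + 1) (a + real j + 1)
      = Gamma (real k + a + 1) ^ 2 / (fact j * fact (k - j) * Gamma (real k + 2 * a + 1 + 1))"
    unfolding 1 2 Beta_def using j G[OF pos(2)] G[OF pos(3)]
    by (simp add: power2_eq_square of_nat_diff algebra_simps)
  also have "\<dots> = real (k choose j) * ((2 * real k + 2 * a + 1) / (real k + 2 * a + 1))
         * ((2 * real k + 2 * a) gchoose k) * (Gamma (real k + a + 1) ^ 2 / Gamma (2 * real k + 2 * a + 1 + 1))"
    unfolding 3 4 5 binomial_fact[OF j] using G[OF pos(4)] G[OF pos(5)] pos(4,5)
    by (simp add: divide_simps)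
  also have "Gamma (real k + a + 1) ^ 2 / Gamma (2 * real k + 2 * a + 1 + 1) = Beta (a + real k + 1) (a + real k + 1)"
    by (simp add: Beta_def power2_eq_square algebra_simps)
  finally show ?thesis using False by simp
qed

text \<open>The projection onto the line spanned by a Jacobi polynomial integrates against this function.
  Up to one common factor it is an alternating binomial combination of weights, each normalized to
  have integral \<open>1\<close>, which explains the shape of the inner sum in \<^const>\<open>Qker\<close>.\<close>

lemma jacobi_jweight_normalized:
  assumes a: "a > -1" and t: "t \<in> {-1..1}"
  shows "jacobi k a a t * jweight a a t / jinner a a (jacobi k a a) (jacobi k a a) =
    (\<Sum>j=0..k. (-1) ^ (k - j) * real (k choose j)
       * (if k = 0 then 1 else (2 * real k + 2 * a + 1) / (real k + 2 * a + 1))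
       * (2 powr (- (real k + 2 * a + 1)) / Beta (a + real (k - j) + 1) (a + real j + 1)
          * jweight (a + real (k - j)) (a + real j) t))"
  unfolding jacobi_jweight[OF t] sum_divide_distrib
proof (intro sum.cong refl)
  fix j assume "j \<in> {0..k}"
  hence j: "j \<le> k" by simp
  define r where "r = (if k = 0 then 1 else (2 * real k + 2 * a + 1) / (real k + 2 * a + 1))"
  define g where "g = ((2 * real k + 2 * a) gchoose k)"
  define Bk where "Bk = Beta (a + real k + 1) (a + real k + 1)"
  define Bj where "Bj = Beta (a + real (k - j) + 1) (a + real j + 1)"
  define cc where "cc = ((real k + a) gchoose j) * ((real k + a) gchoose (k - j))"
  have pos: "g > 0" "Bk > 0" "Bj > 0"
    using a gbinomial_leading_pos[of "2 * a" k] by (auto simp: g_def Bk_def Bj_def Beta_def Gamma_real_pos)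
  have "cc * Bj = real (k choose j) * r * g * Bk"
    using gbinomial_mult_Beta[OF a j] by (simp only: cc_def Bj_def r_def g_def Bk_def)
  hence cc: "cc / (g * Bk) = real (k choose j) * r / Bj"
    using pos by (simp add: field_simps)
  have N: "jinner a a (jacobi k a a) (jacobi k a a) = g * 2 powr (2 * a + 1) * Bk"
  proof -
    have "2 * real k + a + a = 2 * real k + 2 * a" "a + a + 1 = 2 * a + 1" by simp_all
    thus ?thesis
      using jinner_jacobi_self[OF a a, of k] by (simp only: g_def Bk_def)
  qed
  have p: "2 powr (- (real k + 2 * a + 1)) = 1 / (2 ^ k * 2 powr (2 * a + 1))"
  proof -
    have "2 powr (- (real k + 2 * a + 1)) = 1 / (2 powr real k * 2 powr (2 * a + 1))"
      by (simp only: powr_minus_divide powr_add[symmetric] add.assoc)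
    thus ?thesis by (simp only: powr_realpow zero_less_numeral)
  qed
  have "(-1) ^ (k - j) / 2 ^ k * cc * jweight (a + real (k - j)) (a + real j) t
        / (g * 2 powr (2 * a + 1) * Bk)
     = (-1) ^ (k - j) * (cc / (g * Bk)) * (1 / (2 ^ k * 2 powr (2 * a + 1)))
        * jweight (a + real (k - j)) (a + real j) t"
    by simp
  also have "\<dots> = (-1) ^ (k - j) * real (k choose j) * r
      * (2 powr (- (real k + 2 * a + 1)) / Bj * jweight (a + real (k - j)) (a + real j) t)"
    unfolding cc p by (simp add: mult_ac)
  finally show "(-1) ^ (k - j) / 2 ^ k * ((real k + a) gchoose j) * ((real k + a) gchoose (k - j))
        * jweight (a + real (k - j)) (a + real j) t / jinner a a (jacobi k a a) (jacobi k a a)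
     = (-1) ^ (k - j) * real (k choose j)
       * (if k = 0 then 1 else (2 * real k + 2 * a + 1) / (real k + 2 * a + 1))
       * (2 powr (- (real k + 2 * a + 1)) / Beta (a + real (k - j) + 1) (a + real j + 1)
          * jweight (a + real (k - j)) (a + real j) t)"
    unfolding N by (simp only: cc_def r_def Bj_def mult.assoc)
qed

lemma set_integrable_rho_mult:
  assumes "c > -1" "d > -1" "continuous_on {-1..1} g"
  shows "set_integrable lborel {-1..1} (\<lambda>t. rho n c d t * g t)"
proof -
  have "set_integrable lborel {-1..1} (\<lambda>t. (2 powr (- (real n + c + d + 1)) * fact n
      / Beta (real n + c + 1) (real n + d + 1)) * (jweight c d t * (jacobi n c d t * g t)))"
    using assms by (intro set_integrable_mult_right set_integrable_jweight_mult continuous_intros)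
  thus ?thesis by (simp add: rho_def mult_ac)
qed

text \<open>In effect \<^const>\<open>rho\<close> is, up to sign, the \<open>n\<close>-th derivative of the probability density proportional to the
  weight with exponents \<open>c + n\<close> and \<open>d + n\<close>: integrating against it averages the \<open>n\<close>-th
  derivative of a function.\<close>

lemma LINT_rho_mult:
  assumes "c > -1" "d > -1"
    and "\<And>k t. k < n \<Longrightarrow> t \<in> {-1<..<1} \<Longrightarrow> (G k has_real_derivative G (Suc k) t) (at t)"
    and "\<And>k. k \<le> n \<Longrightarrow> continuous_on {-1..1} (G k)"
  shows "(LINT t:{-1..1}|lborel. rho n c d t * G 0 t)
       = 2 powr (- (2 * real n + c + d + 1)) / Beta (real n + c + 1) (real n + d + 1)
         * (LINT t:{-1..1}|lborel. jweight (c + real n) (d + real n) t * G n t)"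
proof -
  define K where "K = 2 powr (- (real n + c + d + 1)) / Beta (real n + c + 1) (real n + d + 1)"
  have "(LINT t:{-1..1}|lborel. rho n c d t * G 0 t)
      = (LINT t:{-1..1}|lborel. K * fact n * (jweight c d t * jacobi n c d t * G 0 t))"
    by (simp add: rho_def K_def mult_ac)
  also have "\<dots> = K * fact n * jinner c d (jacobi n c d) (G 0)"
    unfolding jinner_def by (rule set_integral_mult_right)
  also have "\<dots> = K / 2 ^ n * (2 ^ n * fact n * jinner c d (jacobi n c d) (G 0))"
    by simp
  also have "2 ^ n * fact n * jinner c d (jacobi n c d) (G 0)
      = (LINT t:{-1..1}|lborel. jweight (c + real n) (d + real n) t * G n t)"
    using assms by (rule jinner_jacobi_eq_integral_deriv)
  also have "K / 2 ^ n = 2 powr (- (2 * real n + c + d + 1)) / Beta (real n + c + 1) (real n + d + 1)"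
  proof -
    have "- (real n + c + d + 1) = - (2 * real n + c + d + 1) + real n"
      by simp
    hence "2 powr (- (real n + c + d + 1)) = 2 powr (- (2 * real n + c + d + 1)) * 2 powr real n"
      by (simp only: powr_add)
    thus ?thesis by (simp add: K_def powr_realpow)
  qed
  finally show ?thesis .
qed

lemma set_integrable_sum_family:
  fixes F :: "'i \<Rightarrow> real \<Rightarrow> real"
  assumes "\<And>i. i \<in> I \<Longrightarrow> set_integrable M A (F i)"
  shows "set_integrable M A (\<lambda>t. \<Sum>i\<in>I. F i t)"
    and "(LINT t:A|M. \<Sum>i\<in>I. F i t) = (\<Sum>i\<in>I. LINT t:A|M. F i t)"
  using assms unfolding set_integrable_def set_lebesgue_integral_def
  by (simp_all add: sum_distrib_left)

text \<open>The weights of the preceding expansion, integrated against the \<open>n\<close>-th derivative \<open>G n\<close>, are traded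
  for \<^const>\<open>rho\<close> integrated against \<open>G 0\<close>. Here \<open>(-1)\<^bsup>k-j\<^esup> = (-1)\<^sup>j\<close> because \<open>k\<close> is even.\<close>

lemma jinner_jacobi_normalized_eq_rho:
  assumes \<alpha>: "\<alpha> > -1" and "even k"
    and G: "\<And>k t. k < n \<Longrightarrow> t \<in> {-1<..<1} \<Longrightarrow> (G k has_real_derivative G (Suc k) t) (at t)"
    and contG: "\<And>k. k \<le> n \<Longrightarrow> continuous_on {-1..1} (G k)"
    and a: "a = \<alpha> + real n"
  shows "jinner a a (jacobi k a a) (G n) / jinner a a (jacobi k a a) (jacobi k a a)
     = (\<Sum>j=0..k. (-1) ^ j * real (k choose j)
         * (if k = 0 then 1 else (2 * real k + 2 * a + 1) / (real k + 2 * a + 1))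
         * (LINT t:{-1..1}|lborel. rho n (\<alpha> + real (k - j)) (\<alpha> + real j) t * G 0 t))"
proof -
  have a1: "a > -1" using \<alpha> a by simp
  define N where "N = jinner a a (jacobi k a a) (jacobi k a a)"
  define r where "r = (if k = 0 then 1 else (2 * real k + 2 * a + 1) / (real k + 2 * a + 1))"
  define w where "w = (\<lambda>j t. 2 powr (- (real k + 2 * a + 1)) / Beta (a + real (k - j) + 1) (a + real j + 1)
          * (jweight (a + real (k - j)) (a + real j) t * G n t))"
  have int: "set_integrable lborel {-1..1} (w j)" for j
    unfolding w_def using a1 by (intro set_integrable_mult_right set_integrable_jweight_mult contG) auto
  have "jinner a a (jacobi k a a) (G n) / N
      = (LINT t:{-1..1}|lborel. jweight a a t * jacobi k a a t * G n t / N)"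
    unfolding jinner_def by (rule set_integral_divide_zero[symmetric])
  also have "\<dots> = (LINT t:{-1..1}|lborel. \<Sum>j=0..k. (-1) ^ (k - j) * real (k choose j) * r * w j t)"
  proof (intro set_lebesgue_integral_cong allI impI)
    fix t :: real assume t: "t \<in> {-1..1}"
    have "jweight a a t * jacobi k a a t * G n t / N = jacobi k a a t * jweight a a t / N * G n t"
      by simp
    also have "\<dots> = (\<Sum>j=0..k. (-1) ^ (k - j) * real (k choose j) * r * w j t)"
      unfolding N_def jacobi_jweight_normalized[OF a1 t] r_def w_def sum_distrib_right
      by (simp only: mult.assoc)
    finally show "jweight a a t * jacobi k a a t * G n t / N
      = (\<Sum>j=0..k. (-1) ^ (k - j) * real (k choose j) * r * w j t)" .
  qed simp
  also have "\<dots> = (\<Sum>j=0..k. (-1) ^ (k - j) * real (k choose j) * r * (LINT t:{-1..1}|lborel. w j t))"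
    by (subst set_integrable_sum_family(2)) (auto intro!: int)
  also have "\<dots> = (\<Sum>j=0..k. (-1) ^ j * real (k choose j) * r
         * (LINT t:{-1..1}|lborel. rho n (\<alpha> + real (k - j)) (\<alpha> + real j) t * G 0 t))"
  proof (intro sum.cong refl)
    fix j assume "j \<in> {0..k}"
    hence j: "j \<le> k" by simp
    have "(LINT t:{-1..1}|lborel. rho n (\<alpha> + real (k - j)) (\<alpha> + real j) t * G 0 t)
       = 2 powr (- (2 * real n + (\<alpha> + real (k - j)) + (\<alpha> + real j) + 1))
         / Beta (real n + (\<alpha> + real (k - j)) + 1) (real n + (\<alpha> + real j) + 1)
         * (LINT t:{-1..1}|lborel. jweight (\<alpha> + real (k - j) + real n) (\<alpha> + real j + real n) t * G n t)"
      using \<alpha> by (intro LINT_rho_mult G contG) auto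
    moreover have eqs: "2 * real n + (\<alpha> + real (k - j)) + (\<alpha> + real j) + 1 = real k + 2 * a + 1"
      "real n + (\<alpha> + real (k - j)) + 1 = a + real (k - j) + 1"
      "real n + (\<alpha> + real j) + 1 = a + real j + 1"
      "\<alpha> + real (k - j) + real n = a + real (k - j)" "\<alpha> + real j + real n = a + real j"
      using j by (simp_all add: a of_nat_diff)
    ultimately have "(LINT t:{-1..1}|lborel. w j t)
       = (LINT t:{-1..1}|lborel. rho n (\<alpha> + real (k - j)) (\<alpha> + real j) t * G 0 t)"
      by (simp only: w_def eqs set_integral_mult_right)
    moreover have "(-1) ^ (k - j) = (-1 :: real) ^ j"
      using \<open>even k\<close> j by (simp add: minus_one_power_iff)
    ultimately show "(-1) ^ (k - j) * real (k choose j) * r * (LINT t:{-1..1}|lborel. w j t)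
       = (-1) ^ j * real (k choose j) * r
         * (LINT t:{-1..1}|lborel. rho n (\<alpha> + real (k - j)) (\<alpha> + real j) t * G 0 t)"
      by simp
  qed
  finally show ?thesis unfolding N_def r_def .
qed

lemma sum_even_index:
  fixes F :: "nat \<Rightarrow> real"
  assumes "even q" "\<And>i. odd i \<Longrightarrow> F i = 0"
  shows "(\<Sum>i=0..q. F i) = (\<Sum>i=0..q div 2. F (2 * i))"
proof -
  obtain m where "q = 2 * m" using assms(1) by blast
  moreover have "(\<Sum>i=0..2 * m. F i) = (\<Sum>i=0..m. F (2 * i))"
    by (induction m) (auto simp: assms(2))
  ultimately show ?thesis by simp
qed

text \<open>Only a change of notation: the coefficients are written in terms of the degree \<open>2 * i\<close> as in the
  lemmas on a single Jacobi polynomial.\<close>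

lemma Qker_mult_eq_sum_rho:
  "Qker \<alpha> n q t * g t = (\<Sum>i=0..q div 2. \<Sum>j=0..2 * i. jacobi (2 * i) (\<alpha> + real n) (\<alpha> + real n) 0 *
     ((-1) ^ j * real ((2 * i) choose j) * (if 2 * i = 0 then 1
        else (2 * real (2 * i) + 2 * (\<alpha> + real n) + 1) / (real (2 * i) + 2 * (\<alpha> + real n) + 1))
      * (rho n (\<alpha> + real (2 * i - j)) (\<alpha> + real j) t * g t)))"
  unfolding Qker_def sum_distrib_right sum_distrib_left
proof (intro sum.cong refl)
  fix i j assume "i \<in> {0..q div 2}" "j \<in> {0..2 * i}"
  hence "\<alpha> + 2 * real i - real j = \<alpha> + real (2 * i - j)" by (simp add: of_nat_diff)
  moreover have "4 * real i + 2 * \<alpha> + 2 * real n + 1 = 2 * real (2 * i) + 2 * (\<alpha> + real n) + 1"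
    "2 * real i + 2 * \<alpha> + 2 * real n + 1 = real (2 * i) + 2 * (\<alpha> + real n) + 1"
    "i = 0 \<longleftrightarrow> 2 * i = 0" by simp_all
  ultimately show "jacobi (2 * i) (\<alpha> + real n) (\<alpha> + real n) 0 *
        ((- 1) ^ j * real ((2 * i) choose j)
           * (if i = 0 then 1
              else (4 * real i + 2 * \<alpha> + 2 * real n + 1) / (2 * real i + 2 * \<alpha> + 2 * real n + 1))
           * rho n (\<alpha> + 2 * real i - real j) (\<alpha> + real j) t) * g t
     = jacobi (2 * i) (\<alpha> + real n) (\<alpha> + real n) 0 *
     ((-1) ^ j * real ((2 * i) choose j) * (if 2 * i = 0 then 1
        else (2 * real (2 * i) + 2 * (\<alpha> + real n) + 1) / (real (2 * i) + 2 * (\<alpha> + real n) + 1))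
      * (rho n (\<alpha> + real (2 * i - j)) (\<alpha> + real j) t * g t))"
    by (simp only: mult.assoc)
qed

lemma set_integrable_Qker_mult:
  assumes "\<alpha> > -1" "continuous_on {-1..1} g"
  shows "set_integrable lborel {-1..1} (\<lambda>t. Qker \<alpha> n q t * g t)"
  unfolding Qker_mult_eq_sum_rho using assms
  by (intro set_integrable_sum_family set_integrable_mult_right set_integrable_rho_mult) auto

text \<open>The representation of the estimator by its kernel, for a function \<open>G 0\<close> on \<open>[-1,1]\<close> whose \<open>n\<close>-th
  derivative is \<open>G n\<close>. Odd degrees are absent from \<^const>\<open>Qker\<close> because the odd Jacobi polynomials
  vanish at the origin.\<close>

lemma LINT_Qker_mult:
  assumes \<alpha>: "\<alpha> > -1" and "even q"
    and G: "\<And>k t. k < n \<Longrightarrow> t \<in> {-1<..<1} \<Longrightarrow> (G k has_real_derivative G (Suc k) t) (at t)"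
    and contG: "\<And>k. k \<le> n \<Longrightarrow> continuous_on {-1..1} (G k)"
    and a: "a = \<alpha> + real n"
  shows "(LINT t:{-1..1}|lborel. Qker \<alpha> n q t * G 0 t)
     = (\<Sum>i=0..q. jinner a a (jacobi i a a) (G n) / jinner a a (jacobi i a a) (jacobi i a a)
            * jacobi i a a 0)"
proof -
  have int: "set_integrable lborel {-1..1} (\<lambda>t. C * (D * (rho n (\<alpha> + real k) (\<alpha> + real j) t * G 0 t)))"
    for C D k j using \<alpha> by (intro set_integrable_mult_right set_integrable_rho_mult contG) auto
  have "(LINT t:{-1..1}|lborel. Qker \<alpha> n q t * G 0 t)
     = (\<Sum>i=0..q div 2. \<Sum>j=0..2 * i. jacobi (2 * i) a a 0 * ((-1) ^ j * real ((2 * i) choose j)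
         * (if 2 * i = 0 then 1 else (2 * real (2 * i) + 2 * a + 1) / (real (2 * i) + 2 * a + 1))
         * (LINT t:{-1..1}|lborel. rho n (\<alpha> + real (2 * i - j)) (\<alpha> + real j) t * G 0 t)))"
    unfolding Qker_mult_eq_sum_rho a[symmetric]
    by (subst set_integrable_sum_family(2), intro set_integrable_sum_family(1) int, intro sum.cong refl,
        subst set_integrable_sum_family(2), intro int, simp only: set_integral_mult_right)
  also have "\<dots> = (\<Sum>i=0..q div 2. jinner a a (jacobi (2 * i) a a) (G n)
      / jinner a a (jacobi (2 * i) a a) (jacobi (2 * i) a a) * jacobi (2 * i) a a 0)"
  proof (intro sum.cong refl)
    fix i :: nat
    have "even (2 * i)" by simp
    from jinner_jacobi_normalized_eq_rho[where G = G, OF \<alpha> this G contG a]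
    show "(\<Sum>j=0..2 * i. jacobi (2 * i) a a 0 * ((-1) ^ j * real ((2 * i) choose j)
         * (if 2 * i = 0 then 1 else (2 * real (2 * i) + 2 * a + 1) / (real (2 * i) + 2 * a + 1))
         * (LINT t:{-1..1}|lborel. rho n (\<alpha> + real (2 * i - j)) (\<alpha> + real j) t * G 0 t)))
       = jinner a a (jacobi (2 * i) a a) (G n)
      / jinner a a (jacobi (2 * i) a a) (jacobi (2 * i) a a) * jacobi (2 * i) a a 0"
      unfolding sum_distrib_left[symmetric] by simp
  qed
  also have "\<dots> = (\<Sum>i=0..q. jinner a a (jacobi i a a) (G n) / jinner a a (jacobi i a a) (jacobi i a a)
            * jacobi i a a 0)"
    using \<open>even q\<close> by (intro sum_even_index[symmetric]) (auto simp: jacobi_odd_0)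
  finally show ?thesis .
qed

text \<open>The rescaled function \<open>t \<mapsto> f (x + h t)\<close> has \<open>j\<close>-th derivative \<open>h\<^sup>j f\<^sup>(\<^sup>j\<^sup>)(x + h t)\<close>, hence the factor
  \<open>h ^ n\<close>.\<close>

lemma affine_est_eq_LINT_Qker:
  assumes \<alpha>: "\<alpha> > -1" and "even q" and h: "h > 0"
    and f: "\<And>j y. j < n \<Longrightarrow> y \<in> {x - h..x + h} \<Longrightarrow> ((deriv ^^ j) f has_real_derivative (deriv ^^ Suc j) f y) (at y)"
    and cont: "\<And>j. j \<le> n \<Longrightarrow> continuous_on {x - h..x + h} ((deriv ^^ j) f)"
  shows "h ^ n * affine_est n h \<alpha> q f x = (LINT t:{-1..1}|lborel. Qker \<alpha> n q t * f (x + h * t))"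
proof -
  define G where "G = (\<lambda>j t. h ^ j * (deriv ^^ j) f (x + h * t))"
  define a where "a = \<alpha> + real n"
  have range: "x + h * t \<in> {x - h..x + h}" if "t \<in> {-1..1}" for t
    using that h mult_left_mono[of t 1 h] mult_left_mono[of "-1" t h] by auto
  have "(G j has_real_derivative G (Suc j) t) (at t)" if "j < n" "t \<in> {-1<..<1}" for j t
  proof -
    have "((deriv ^^ j) f has_real_derivative (deriv ^^ Suc j) f (x + h * t)) (at (x + h * t))"
      using that range[of t] by (intro f) auto
    hence "((\<lambda>t. (deriv ^^ j) f (x + h * t)) has_real_derivative (deriv ^^ Suc j) f (x + h * t) * h) (at t)"
      by (rule DERIV_chain2) (auto intro!: derivative_eq_intros)
    from DERIV_cmult[OF this, of "h ^ j"] show ?thesis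
      unfolding G_def by (rule DERIV_cong) simp
  qed
  moreover have "continuous_on {-1..1} (G j)" if "j \<le> n" for j
    unfolding G_def using range
    by (intro continuous_intros continuous_on_compose2[OF cont[OF that]]) auto
  ultimately have "(LINT t:{-1..1}|lborel. Qker \<alpha> n q t * G 0 t)
     = (\<Sum>i=0..q. jinner a a (jacobi i a a) (G n) / jinner a a (jacobi i a a) (jacobi i a a)
            * jacobi i a a 0)"
    using \<alpha> \<open>even q\<close> by (intro LINT_Qker_mult) (auto simp: a_def)
  also have "\<dots> = h ^ n * affine_est n h \<alpha> q f x"
  proof -
    have "jinner a a (jacobi i a a) (G n)
        = h ^ n * jinner a a (jacobi i a a) (\<lambda>t. (deriv ^^ n) f (x + h * t))" for i
      unfolding jinner_def G_def by (simp add: mult.left_commute[of _ "h ^ n"])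
    moreover have "(jnorm a a (jacobi i a a))\<^sup>2 = jinner a a (jacobi i a a) (jacobi i a a)" for i
      using jinner_jacobi_self_pos[of a a i] \<alpha> by (simp add: jnorm_def a_def)
    ultimately show ?thesis
      by (simp add: affine_est_def a_def[symmetric] sum_distrib_left mult.assoc)
  qed
  finally show ?thesis by (simp add: G_def)
qed

section \<open>The Taylor remainder and the error bound\<close>

text \<open>The moment conditions on the kernel: it returns the \<open>n\<close>-th derivative at the origin for all
  polynomials of degree up to \<open>n + q + 1\<close>, as their \<open>n\<close>-th derivatives have degree at most
  \<open>q + 1\<close>.\<close>

lemma LINT_Qker_poly:
  assumes \<alpha>: "\<alpha> > -1" and "even q" and deg: "Polynomial.degree p \<le> n + q + 1"
  shows "(LINT t:{-1..1}|lborel. Qker \<alpha> n q t * poly p t) = fact n * coeff p n"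
proof -
  define a where "a = \<alpha> + real n"
  have "(LINT t:{-1..1}|lborel. Qker \<alpha> n q t * poly ((pderiv ^^ 0) p) t)
     = (\<Sum>i=0..q. jinner a a (jacobi i a a) (poly ((pderiv ^^ n) p))
          / jinner a a (jacobi i a a) (jacobi i a a) * jacobi i a a 0)"
    using \<alpha> \<open>even q\<close>
    by (intro LINT_Qker_mult[where G = "\<lambda>j. poly ((pderiv ^^ j) p)"])
      (auto simp: a_def intro!: poly_DERIV continuous_intros)
  also have "\<dots> = poly ((pderiv ^^ n) p) 0"
    using \<alpha> \<open>even q\<close> deg by (intro jacobi_expansion_0) (auto simp: a_def degree_higher_pderiv)
  also have "\<dots> = fact n * coeff p n"
    by (simp add: poly_0_coeff_0 coeff_higher_pderiv pochhammer_fact)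
  finally show ?thesis by simp
qed

text \<open>The kernel is exact on the Taylor polynomial of degree \<open>n + q + 1\<close> at \<open>x\<close>, so the error is the
  integral of the kernel against the Taylor remainder, divided by \<open>h ^ n\<close>. Only a bound for the highest
  derivative on \<open>[x - h, x + h]\<close> enters; hence the lemma serves the local asymptotic
  statement as well as the uniform one.\<close>

lemma affine_est_error:
  fixes f :: "real \<Rightarrow> real"
  assumes \<alpha>: "\<alpha> > -1" and "even q" and h: "h > 0"
    and f: "\<And>j y. j < n + q + 2 \<Longrightarrow> y \<in> {x - h..x + h} \<Longrightarrow>
              ((deriv ^^ j) f has_real_derivative (deriv ^^ Suc j) f y) (at y)"
    and M: "\<And>y. y \<in> {x - h..x + h} \<Longrightarrow> \<bar>(deriv ^^ (n + q + 2)) f y\<bar> \<le> M"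
  shows "\<bar>affine_est n h \<alpha> q f x - (deriv ^^ n) f x\<bar>
    \<le> M / fact (n + q + 2) * (LINT t:{-1..1}|lborel. \<bar>t ^ (n + q + 2) * Qker \<alpha> n q t\<bar>) * h ^ (q + 2)"
proof -
  define N where "N = n + q + 2"
  define T where "T = (\<Sum>k<N. monom (h ^ k * (deriv ^^ k) f x / fact k) k)"
  define R where "R = (\<lambda>t. f (x + h * t) - poly T t)"
  define Q where "Q = Qker \<alpha> n q"
  have range: "x + h * t \<in> {x - h..x + h}" if "t \<in> {-1..1}" for t
    using that h mult_left_mono[of t 1 h] mult_left_mono[of "-1" t h] by auto
  have cont: "continuous_on {x - h..x + h} ((deriv ^^ j) f)" if "j < N" for j
  proof (rule DERIV_continuous_on)
    fix y assume "y \<in> {x - h..x + h}"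
    with that have "((deriv ^^ j) f has_real_derivative (deriv ^^ Suc j) f y) (at y)"
      unfolding N_def by (rule f)
    thus "((deriv ^^ j) f has_real_derivative (deriv ^^ Suc j) f y) (at y within {x - h..x + h})"
      by (rule has_field_derivative_at_within)
  qed
  have contf: "continuous_on {-1..1} (\<lambda>t. f (x + h * t))"
  proof (rule continuous_on_compose2[of "{x - h..x + h}" f "{-1..1}" "\<lambda>t. x + h * t"])
    show "continuous_on {x - h..x + h} f"
      using cont[of 0] by (simp add: N_def)
    show "continuous_on {-1..1} (\<lambda>t. x + h * t)"
      by (intro continuous_intros)
    show "(\<lambda>t. x + h * t) ` {-1..1} \<subseteq> {x - h..x + h}"
      using range by blast
  qed
  have contR: "continuous_on {-1..1} R"
    unfolding R_def by (intro continuous_intros contf)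
  have R: "\<bar>R t\<bar> \<le> M / fact N * h ^ N * \<bar>t ^ N\<bar>" if t: "t \<in> {-1..1}" for t
  proof (cases "t = 0")
    case True
    have "(\<Sum>k<N. coeff (monom (h ^ k * (deriv ^^ k) f x / fact k) k) 0) = f x"
      by (subst sum.mono_neutral_right[of _ "{0}"]) (auto simp: N_def)
    thus ?thesis
      using True by (simp add: R_def T_def poly_0_coeff_0 coeff_sum N_def)
  next
    case False
    have "\<exists>s. (if x + h * t < x then x + h * t < s \<and> s < x else x < s \<and> s < x + h * t) \<and>
      f (x + h * t) = (\<Sum>k<N. ((deriv ^^ k) f x / fact k) * (x + h * t - x) ^ k)
        + ((deriv ^^ N) f s / fact N) * (x + h * t - x) ^ N"
    proof (rule Taylor[where a = "x - h" and b = "x + h"])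
      show "\<forall>m s. m < N \<and> x - h \<le> s \<and> s \<le> x + h \<longrightarrow>
          ((deriv ^^ m) f has_real_derivative (deriv ^^ Suc m) f s) (at s)"
        unfolding N_def by (intro allI impI f) simp_all
    qed (use h range[OF t] False in \<open>simp_all add: N_def\<close>)
    then obtain s where s: "if x + h * t < x then x + h * t < s \<and> s < x else x < s \<and> s < x + h * t"
      and eq: "f (x + h * t) = (\<Sum>k<N. ((deriv ^^ k) f x / fact k) * (x + h * t - x) ^ k)
        + ((deriv ^^ N) f s / fact N) * (x + h * t - x) ^ N" by blast
    have "R t = ((deriv ^^ N) f s / fact N) * (h * t) ^ N"
      unfolding R_def eq T_def by (simp add: poly_sum poly_monom power_mult_distrib mult_ac)
    hence "\<bar>R t\<bar> = \<bar>(deriv ^^ N) f s\<bar> / fact N * h ^ N * \<bar>t ^ N\<bar>"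
      using h by (simp add: abs_mult power_mult_distrib)
    also have "\<dots> \<le> M / fact N * h ^ N * \<bar>t ^ N\<bar>"
    proof -
      have "x - h \<le> x + h * t \<and> x + h * t \<le> x + h"
        using range[OF t] by (simp only: atLeastAtMost_iff)
      moreover have "x + h * t < s \<and> s < x \<or> x < s \<and> s < x + h * t"
        using s by argo
      ultimately have "s \<in> {x - h..x + h}"
        unfolding atLeastAtMost_iff using h by argo
      from M[OF this] show ?thesis
        using h by (intro mult_right_mono divide_right_mono) (auto simp: N_def)
    qed
    finally show ?thesis .
  qed
  have degT: "Polynomial.degree T \<le> n + q + 1"
    unfolding T_def by (intro degree_sum_le order.trans[OF degree_monom_le]) (auto simp: N_def)
  have coeffT: "fact n * coeff T n = h ^ n * (deriv ^^ n) f x"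
    unfolding T_def coeff_sum coeff_monom by (simp add: N_def)
  have intf: "set_integrable lborel {-1..1} (\<lambda>t. Q t * f (x + h * t))"
    and intT: "set_integrable lborel {-1..1} (\<lambda>t. Q t * poly T t)"
    and intR: "set_integrable lborel {-1..1} (\<lambda>t. Q t * R t)"
    and intQ: "set_integrable lborel {-1..1} (\<lambda>t. Q t * t ^ N)"
    unfolding Q_def using \<alpha> by (intro set_integrable_Qker_mult contf contR continuous_intros; simp)+
  \<comment> \<open>The term \<open>h ^ n * (deriv ^^ n) f x\<close> is the kernel integral of the Taylor polynomial.\<close>
  have "h ^ n * (affine_est n h \<alpha> q f x - (deriv ^^ n) f x)
      = (LINT t:{-1..1}|lborel. Q t * f (x + h * t)) - (LINT t:{-1..1}|lborel. Q t * poly T t)"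
    unfolding Q_def LINT_Qker_poly[OF \<alpha> \<open>even q\<close> degT] right_diff_distrib coeffT
  proof -
    have "h ^ n * affine_est n h \<alpha> q f x = (LINT t:{-1..1}|lborel. Qker \<alpha> n q t * f (x + h * t))"
      using \<alpha> \<open>even q\<close> h
    proof (rule affine_est_eq_LINT_Qker)
      show "((deriv ^^ j) f has_real_derivative (deriv ^^ Suc j) f y) (at y)"
        if "j < n" "y \<in> {x - h..x + h}" for j y
        using that by (intro f) simp_all
    qed (simp add: cont N_def)
    thus "h ^ n * affine_est n h \<alpha> q f x - h ^ n * (deriv ^^ n) f x
      = (LINT t:{-1..1}|lborel. Qker \<alpha> n q t * f (x + h * t)) - h ^ n * (deriv ^^ n) f x"
      by simp
  qed
  also have "\<dots> = (LINT t:{-1..1}|lborel. Q t * R t)"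
    using intf intT by (subst set_integral_diff(2)[symmetric]) (auto simp: R_def algebra_simps)
  finally have "h ^ n * \<bar>affine_est n h \<alpha> q f x - (deriv ^^ n) f x\<bar> = \<bar>LINT t:{-1..1}|lborel. Q t * R t\<bar>"
    using h by (metis abs_mult abs_of_pos zero_less_power)
  also have "\<dots> \<le> (LINT t:{-1..1}|lborel. \<bar>Q t * R t\<bar>)"
    using set_integral_norm_bound[OF intR] by simp
  also have "\<dots> \<le> (LINT t:{-1..1}|lborel. M / fact N * h ^ N * \<bar>t ^ N * Q t\<bar>)"
  proof (rule set_integral_mono)
    show "set_integrable lborel {-1..1} (\<lambda>t. \<bar>Q t * R t\<bar>)"
      using intR by (rule set_integrable_abs)
    show "set_integrable lborel {-1..1} (\<lambda>t. M / fact N * h ^ N * \<bar>t ^ N * Q t\<bar>)"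
      using set_integrable_abs[OF intQ] by (intro set_integrable_mult_right) (simp add: mult.commute)
    fix t :: real assume "t \<in> {-1..1}"
    from mult_left_mono[OF R[OF this], of "\<bar>Q t\<bar>"]
    show "\<bar>Q t * R t\<bar> \<le> M / fact N * h ^ N * \<bar>t ^ N * Q t\<bar>"
      by (simp add: abs_mult mult_ac)
  qed
  also have "\<dots> = h ^ n * (M / fact N * (LINT t:{-1..1}|lborel. \<bar>t ^ N * Q t\<bar>) * h ^ (q + 2))"
    unfolding set_integral_mult_right by (simp add: N_def power_add mult_ac)
  finally show ?thesis
    unfolding N_def Q_def by (rule mult_left_le_imp_le) (use h in simp)
qed

theorem corollary13:
  fixes I :: "real set" and n q :: nat and \<alpha> :: real and f :: "real \<Rightarrow> real"
  assumes "open I" and "is_interval I"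
    and "even q"
    and "\<alpha> > -1"
    and "C_on (n + 2 + q) I f"
  shows "(\<forall>x\<in>I. (\<lambda>h. affine_est n h \<alpha> q f x - (deriv ^^ n) f x) \<in> O[at_right 0](\<lambda>h. h ^ (q + 2)))
    \<and> (\<forall>M>0. (\<forall>x\<in>I. \<bar>(deriv ^^ (n + q + 2)) f x\<bar> \<le> M) \<longrightarrow>
         (\<forall>h>0. sup_norm_on (shrink I h) (\<lambda>x. affine_est n h \<alpha> q f x - (deriv ^^ n) f x)
            \<le> ereal (M / fact (n + q + 2)
                * (LINT t:{-1..1}|lborel. \<bar>t ^ (n + q + 2) * Qker \<alpha> n q t\<bar>) * h ^ (q + 2))))"
proof -
  define C where "C = (LINT t:{-1..1}|lborel. \<bar>t ^ (n + q + 2) * Qker \<alpha> n q t\<bar>)"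
  have f: "((deriv ^^ j) f has_real_derivative (deriv ^^ Suc j) f y) (at y)" if "j < n + q + 2" "y \<in> I" for j y
  proof -
    have "(deriv ^^ j) f field_differentiable (at y)"
      using assms(5) that by (simp add: C_on_def add_ac)
    thus ?thesis by (simp add: DERIV_deriv_iff_field_differentiable)
  qed
  have contf: "continuous_on I ((deriv ^^ (n + q + 2)) f)"
    using assms(5) by (simp add: C_on_def add_ac)
  have bound: "\<bar>affine_est n h \<alpha> q f x - (deriv ^^ n) f x\<bar> \<le> M / fact (n + q + 2) * C * h ^ (q + 2)"
    if "h > 0" "{x - h..x + h} \<subseteq> I" "\<And>y. y \<in> {x - h..x + h} \<Longrightarrow> \<bar>(deriv ^^ (n + q + 2)) f y\<bar> \<le> M" for h x M
    unfolding C_def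
  proof (rule affine_est_error)
    show "((deriv ^^ j) f has_real_derivative (deriv ^^ Suc j) f y) (at y)"
      if "j < n + q + 2" "y \<in> {x - h..x + h}" for j y
      using that \<open>{x - h..x + h} \<subseteq> I\<close> by (blast intro: f)
    show "\<bar>(deriv ^^ (n + q + 2)) f y\<bar> \<le> M" if "y \<in> {x - h..x + h}" for y
      using that by fact
  qed fact+
  have "(\<lambda>h. affine_est n h \<alpha> q f x - (deriv ^^ n) f x) \<in> O[at_right 0](\<lambda>h. h ^ (q + 2))" if "x \<in> I" for x
  proof -
    \<comment> \<open>The constant has to be uniform in \<open>h\<close>; a bound of the continuous highest derivative on one fixed
      compact neighbourhood of \<open>x\<close> provides it.\<close>
    have "\<exists>e>0. cball x e \<subseteq> I"
      using assms(1) that by (simp add: open_contains_cball)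
    then obtain e where e: "e > 0" "cball x e \<subseteq> I"
      by blast
    hence sub: "{x - e..x + e} \<subseteq> I" by (simp add: cball_eq_atLeastAtMost)
    obtain M where M: "\<forall>y\<in>{x - e..x + e}. \<bar>(deriv ^^ (n + q + 2)) f y\<bar> \<le> M"
      using compact_imp_bounded[OF compact_continuous_image[OF continuous_on_subset[OF contf sub] compact_Icc]]
      unfolding bounded_iff by auto
    have "eventually (\<lambda>h. h \<in> {0<..<e}) (at_right 0)"
      using e(1) by (simp add: eventually_at_right_less eventually_at_right_field) blast
    hence "eventually (\<lambda>h. norm (affine_est n h \<alpha> q f x - (deriv ^^ n) f x)
        \<le> (M / fact (n + q + 2) * C) * norm (h ^ (q + 2))) (at_right 0)"
    proof eventually_elim
      case (elim h)
      hence "{x - h..x + h} \<subseteq> {x - e..x + e}" by auto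
      hence "\<bar>affine_est n h \<alpha> q f x - (deriv ^^ n) f x\<bar> \<le> M / fact (n + q + 2) * C * h ^ (q + 2)"
        using elim sub M by (intro bound) auto
      thus ?case using elim by (simp add: abs_mult)
    qed
    thus ?thesis by (rule bigoI)
  qed
  moreover have "sup_norm_on (shrink I h) (\<lambda>x. affine_est n h \<alpha> q f x - (deriv ^^ n) f x)
      \<le> ereal (M / fact (n + q + 2) * C * h ^ (q + 2))"
    if "\<forall>x\<in>I. \<bar>(deriv ^^ (n + q + 2)) f x\<bar> \<le> M" "h > 0" for M h
    unfolding sup_norm_on_def
  proof (rule SUP_least)
    fix x assume "x \<in> shrink I h"
    hence "{x - h..x + h} \<subseteq> I" by (simp add: shrink_def)
    thus "ereal \<bar>affine_est n h \<alpha> q f x - (deriv ^^ n) f x\<bar> \<le> ereal (M / fact (n + q + 2) * C * h ^ (q + 2))"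
      using that bound[of h x M] by (auto simp: subset_iff)
  qed
  ultimately show ?thesis unfolding C_def by blast
qed

end
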